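(* Let $p,q\ge 0$ be integers and let $a_1,\dots,a_p,b_1,\dots,b_q$ be arbitrary constants. For every integer $N\ge 0$ put $$F_N(x)={}_{p+N+1}F_{q+N+1}\Bigl(a_1,\dots,a_p,\tfrac{\alpha+1}{\gamma},\tfrac{\alpha+\beta+1}{\gamma},\dots,\tfrac{\alpha+N\beta+1}{\gamma};\,b_1,\dots,b_q,\tfrac{\alpha+\gamma+1}{\gamma},\tfrac{\alpha+\gamma+\beta+1}{\gamma},\dots,\tfrac{\alpha+\gamma+N\beta+1}{\gamma};\,\lambda x^{\gamma}\Bigr).$$ Then, for any constants $\alpha,\beta,\eta,\lambda$ and any nonzero constant $\gamma$, $$\sinh(\eta x^\beta)\sum_{j=0}^{\infty}\frac{(\beta\eta x^\beta)^{2j}}{\prod_{m=0}^{2j}(\alpha+m\beta+1)}F_{2j}(x)-\cosh(\eta x^\beta)\sum_{j=0}^{\infty}\frac{(\beta\eta x^\beta)^{2j+1}}{\prod_{m=0}^{2j+1}(\alpha+m\beta+1)}F_{2j+1}(x)$$ $$=\frac12\left[e^{\eta x^\beta}\sum_{j=0}^{\infty}\frac{(-\beta\eta x^\beta)^{j}}{\prod_{m=0}^{j}(\alpha+m\beta+1)}F_{j}(x)-e^{-\eta x^\beta}\sum_{j=0}^{\infty}\frac{(\beta\eta x^\beta)^{j}}{\prod_{m=0}^{j}(\alpha+m\beta+1)}F_{j}(x)\right].$$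
   Context: Constants are real or complex. The generalized hypergeometric function is defined by the series $${}_pF_q(a_1,\dots,a_p;b_1,\dots,b_q;x)=\sum_{n=0}^{\infty}\frac{(a_1)_n\cdots(a_p)_n}{(b_1)_n\cdots(b_q)_n}\frac{x^n}{n!},$$ with Pochhammer symbol $(\vartheta)_n=\Gamma(\vartheta+n)/\Gamma(\vartheta)$, $(\vartheta)_0=1$. *)

theory Defs
  imports "HOL-Analysis.Analysis"
begin

definition pFq :: "complex list \<Rightarrow> complex list \<Rightarrow> complex \<Rightarrow> complex" where
  "pFq as bs z = eval_fps (fps_hypergeo as bs 1) z"

lemma pFq_series:
  "pFq as bs z =
     (\<Sum>n. (\<Prod>a\<leftarrow>as. pochhammer a n) / (\<Prod>b\<leftarrow>bs. pochhammer b n) * z ^ n / fact n)"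
proof -
  have "foldl (\<lambda>r c. r * pochhammer c n) v cs = v * (\<Prod>c\<leftarrow>cs. pochhammer c n)"
    for v :: complex and cs n
    by (induction cs arbitrary: v) (simp_all add: mult.assoc)
  then show ?thesis
    unfolding pFq_def eval_fps_def by (simp add: field_simps)
qed

(* Powers x^beta, x^gamma use the principal branch. The lists as, bs have the arbitrary
   lengths p and q; the appended lists run over m = 0, ..., N. *)
definition hyp_F ::
  "complex list \<Rightarrow> complex list \<Rightarrow> complex \<Rightarrow> complex \<Rightarrow> complex \<Rightarrow> complex \<Rightarrow> nat \<Rightarrow> complex \<Rightarrow> complex"
where
  "hyp_F as bs \<alpha> \<beta> \<gamma> l N x =
     pFq (as @ map (\<lambda>m. (\<alpha> + of_nat m * \<beta> + 1) / \<gamma>) [0..<Suc N])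
         (bs @ map (\<lambda>m. (\<alpha> + \<gamma> + of_nat m * \<beta> + 1) / \<gamma>) [0..<Suc N])
         (l * x powr \<gamma>)"

end

theory Submission
  imports Defs
begin

text \<open>
  The identity is the even-odd splitting of a series, for any coefficients. Put \<open>t = \<eta> x\<^sup>\<beta>\<close> and let
  \<open>G j\<close> be the \<open>j\<close>-th summand of the last series, with even part \<open>E\<close> (the sum of the \<open>G (2 j)\<close>)
  and odd part \<open>D\<close> (the sum of the \<open>G (2 j + 1)\<close>). Changing the sign of the base \<open>\<beta> t\<close> multiplies
  \<open>G j\<close> by \<open>(-1)\<^sup>j\<close>, so the two series on the right are \<open>E - D\<close> and \<open>E + D\<close>, and
  \[ \sinh t \cdot E - \cosh t \cdot D = \frac12 \bigl(e^t (E - D) - e^{-t} (E + D)\bigr) \]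
  is the definition of the hyperbolic functions, with terms rearranged. The only analytic point is
  the recombination of the even and odd parts into one series, which is the content of
  \<open>sums_even_odd\<close>; convergence of the two parts is enough, and it need not be absolute.
\<close>

text \<open>
  Interleaving zeros does not affect convergence. Hence the even-indexed terms, padded with zeros
  at the odd places, and the odd-indexed terms, padded likewise, are two convergent series that
  add up termwise to the whole.
\<close>

lemma sums_even_odd:
  fixes f :: "nat \<Rightarrow> 'a::real_normed_vector"
  assumes even_part: "(\<lambda>j. f (2 * j)) sums a"
    and odd_part: "(\<lambda>j. f (2 * j + 1)) sums b"
  shows "f sums (a + b)"
proof -
  have "(\<lambda>n. if even n then f n else 0) sums a"
    using even_part
    by (subst sums_mono_reindex[of "\<lambda>j. 2 * j", symmetric])
       (auto simp: strict_mono_def elim!: evenE)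
  moreover have "(\<lambda>n. if odd n then f n else 0) sums b"
    using odd_part
    by (subst sums_mono_reindex[of "\<lambda>j. 2 * j + 1", symmetric])
       (auto simp: strict_mono_def elim!: oddE)
  ultimately have "(\<lambda>n. (if even n then f n else 0) + (if odd n then f n else 0)) sums (a + b)"
    by (rule sums_add)
  moreover have "(\<lambda>n. (if even n then f n else 0) + (if odd n then f n else 0)) = f"
    by auto
  ultimately show ?thesis
    by simp
qed

text \<open>
  Passing from \<open>y\<close> to \<open>-y\<close> keeps the even part of the series and negates the odd part. In the
  application \<open>y = \<beta> t\<close>, and \<open>c j\<close> collects the hypergeometric function and the reciprocal of the
  product in front of it.
\<close>

lemma sinh_cosh_even_odd_series:
  fixes t y :: "'a::{banach, real_normed_field}" and c :: "nat \<Rightarrow> 'a"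
  assumes even_part: "summable (\<lambda>j. y ^ (2 * j) * c (2 * j))"
    and odd_part: "summable (\<lambda>j. y ^ (2 * j + 1) * c (2 * j + 1))"
  shows "sinh t * (\<Sum>j. y ^ (2 * j) * c (2 * j)) - cosh t * (\<Sum>j. y ^ (2 * j + 1) * c (2 * j + 1))
    = 1 / 2 * (exp t * (\<Sum>j. (- y) ^ j * c j) - exp (- t) * (\<Sum>j. y ^ j * c j))"
proof -
  define E where "E = (\<Sum>j. y ^ (2 * j) * c (2 * j))"
  define D where "D = (\<Sum>j. y ^ (2 * j + 1) * c (2 * j + 1))"
  have E: "(\<lambda>j. y ^ (2 * j) * c (2 * j)) sums E"
    unfolding E_def by (rule summable_sums[OF even_part])
  have D: "(\<lambda>j. y ^ (2 * j + 1) * c (2 * j + 1)) sums D"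
    unfolding D_def by (rule summable_sums[OF odd_part])
  have "(\<lambda>j. y ^ j * c j) sums (E + D)"
    by (rule sums_even_odd[OF E D])
  moreover have "(\<lambda>j. (- y) ^ j * c j) sums (E + - D)"
    using E sums_minus[OF D] by (intro sums_even_odd) simp_all
  ultimately have "(\<Sum>j. y ^ j * c j) = E + D" "(\<Sum>j. (- y) ^ j * c j) = E - D"
    by (simp_all add: sums_iff)
  then show ?thesis
    unfolding E_def[symmetric] D_def[symmetric] sinh_field_def cosh_field_def
    by (simp only:) (simp add: field_simps)
qed

theorem theorem2:
  fixes as bs :: "complex list" and \<alpha> \<beta> \<gamma> \<eta> l x :: complex
  assumes "\<gamma> \<noteq> 0"
    and "summable (\<lambda>j. (\<beta> * \<eta> * x powr \<beta>) ^ (2 * j) / (\<Prod>m=0..2 * j. \<alpha> + of_nat m * \<beta> + 1)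
           * hyp_F as bs \<alpha> \<beta> \<gamma> l (2 * j) x)"
    and "summable (\<lambda>j. (\<beta> * \<eta> * x powr \<beta>) ^ (2 * j + 1) / (\<Prod>m=0..2 * j + 1. \<alpha> + of_nat m * \<beta> + 1)
           * hyp_F as bs \<alpha> \<beta> \<gamma> l (2 * j + 1) x)"
  shows
    "sinh (\<eta> * x powr \<beta>)
       * (\<Sum>j. (\<beta> * \<eta> * x powr \<beta>) ^ (2 * j) / (\<Prod>m=0..2 * j. \<alpha> + of_nat m * \<beta> + 1)
           * hyp_F as bs \<alpha> \<beta> \<gamma> l (2 * j) x)
     - cosh (\<eta> * x powr \<beta>)
       * (\<Sum>j. (\<beta> * \<eta> * x powr \<beta>) ^ (2 * j + 1) / (\<Prod>m=0..2 * j + 1. \<alpha> + of_nat m * \<beta> + 1)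
           * hyp_F as bs \<alpha> \<beta> \<gamma> l (2 * j + 1) x)
     = 1 / 2 *
       (exp (\<eta> * x powr \<beta>)
          * (\<Sum>j. (- (\<beta> * \<eta> * x powr \<beta>)) ^ j / (\<Prod>m=0..j. \<alpha> + of_nat m * \<beta> + 1)
              * hyp_F as bs \<alpha> \<beta> \<gamma> l j x)
        - exp (- (\<eta> * x powr \<beta>))
          * (\<Sum>j. (\<beta> * \<eta> * x powr \<beta>) ^ j / (\<Prod>m=0..j. \<alpha> + of_nat m * \<beta> + 1)
              * hyp_F as bs \<alpha> \<beta> \<gamma> l j x))"
  using sinh_cosh_even_odd_series[of "\<beta> * \<eta> * x powr \<beta>"
      "\<lambda>j. inverse (\<Prod>m=0..j. \<alpha> + of_nat m * \<beta> + 1) * hyp_F as bs \<alpha> \<beta> \<gamma> l j x" "\<eta> * x powr \<beta>"]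
    assms(2,3)
  unfolding divide_inverse mult.assoc by blast

end
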